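(* The following statements for a curve $\gamma\in\mathcal{M}$ are equivalent: (i) $\gamma$ is $E_{k+1}$ critical under constraints $E_1,\dots,E_k$. (ii) $\gamma$ is $E_k$ critical under constraints $E_{-1},\dots,E_{k-1}$. (iii) $\gamma$ is $E_{k-1}$ critical under constraints $E_{-2},\dots,E_{k-2}$. (iv) The flow $\dot\gamma=Y_k$ evolves, modulo a linear combination of lower order flows, by a pure translation in the direction of the axis of the monodromy of the initial curve $\gamma$. (v) The flow $\dot\gamma=Y_{k-1}$ evolves, modulo a linear combination of lower order flows, by a Euclidean motion with axis along the monodromy of the initial curve $\gamma$.
   Context: Let $M\cong\mathbb{R}$ be an oriented 1-manifold with a fixed translation $\tau\in\mathrm{Diff}(M)$, $M/\tau\cong S^1$. Let $h(p)=Ap+a$ be an orientation preserving Euclidean motion ($A\in SO(3)$, $a\in\mathbb{R}^3$), and let $\mathcal{M}$ be the space of smooth immersions $\gamma\colon M\to\mathbb{R}^3$ with monodromy $h$, that is, $\gamma\circ\tau=h\circ\gamma$. Let $v\in\mathbb{R}^3$ be a unit length eigenvector of the rotational part $A$ of the monodromy, so that the vector fields $p\mapsto v$ and $p\mapsto v\times p$ are $h$-related to themselves; the origin of $\mathbb{R}^3$ is chosen to lie on the axis $\mathbb{R}v$. Let $(\ )'$ be the derivative with respect to arclength of $\gamma$, and $T=\gamma'$. The vector fields $Y_k$ on $\mathcal{M}$ are defined by $Y_{-2}=v\times\gamma$, $Y_{-1}=v$, $Y_0=T$, and $Y_{k+1}=T\times Y_k'-\frac12\sum_{i=1}^k(Y_i,Y_{k-i+1})T$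 for $k\ge0$. $E_k\colon\mathcal{M}\to\mathbb{R}$ denotes the (putative) Hamiltonian for the flow $Y_k$, with $E_0=0$; its variational gradient is $G_k=T\times Y_k$ (so $G_0=0$), and $G_{k+1}=-Y_k'$. A curve $\gamma$ is critical for $E_m$ under the constraints $E_{i_1},\dots,E_{i_r}$ if the constrained Euler–Lagrange equation $G_m=\sum_jc_{i_j}G_{i_j}$ holds along $\gamma$ for some constants (Lagrange multipliers) $c_{i_j}\in\mathbb{R}$. Here $k$ is a positive integer index. Statement (iv) expresses that $Y_k=\sum_{i=0}^{k-1}c_iY_i+w$ along $\gamma$ for some $c_i\in\mathbb{R}$ and some $w\in\mathbb{R}^3$, where $w$ is necessarily an eigenvector of the rotational part of the monodromy of $\gamma$.
   Formalization: (iii) is included only for k≥2, since for k=1 it holds for every curve (G_0=0). If A=I the axis is not determined by the monodromy: the equivalence is claimed for some suitable axis, while (i)⇔(iv) and each of (ii),(iii),(v)⇒(i) hold for every axis. *)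

theory Defs
  imports "HOL-Analysis.Analysis"
begin

text \<open>
  The oriented 1-manifold \<open>M\<close>, being diffeomorphic to the real line, is taken to be \<open>real\<close>.
\<close>

definition smooth :: "(real \<Rightarrow> 'a::real_normed_vector) \<Rightarrow> bool" where
  "smooth f \<longleftrightarrow>
     (\<forall>n x. ((\<lambda>g y. vector_derivative g (at y)) ^^ n) f differentiable (at x))"

text \<open>
  A diffeomorphism \<open>\<tau>\<close> of the line has quotient \<open>M/\<tau>\<close> diffeomorphic to the circle iff it has no
  fixed point; such a \<open>\<tau>\<close> is automatically increasing, hence preserves the orientation.
\<close>

definition line_translation :: "(real \<Rightarrow> real) \<Rightarrow> bool" where
  "line_translation \<tau> \<longleftrightarrow> bij \<tau> \<and> smooth \<tau> \<and> smooth (inv \<tau>) \<and> (\<forall>x. \<tau> x \<noteq> x)"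

text \<open>The space of immersions with monodromy \<open>p \<mapsto> A p + a\<close>.\<close>

definition curves :: "(real \<Rightarrow> real) \<Rightarrow> real^3^3 \<Rightarrow> real^3 \<Rightarrow> (real \<Rightarrow> real^3) set" where
  "curves \<tau> A a = {\<gamma>. smooth \<gamma> \<and> (\<forall>x. vector_derivative \<gamma> (at x) \<noteq> 0) \<and>
                      (\<forall>x. \<gamma> (\<tau> x) = A *v \<gamma> x + a)}"

text \<open>
  The line \<open>q + \<real>v\<close> is an axis of \<open>h p = A p + a\<close>. Given \<open>A v = v\<close>, the last condition
  says \<open>h q \<in> q + \<real>v\<close>; together they say that the vector fields \<open>p \<mapsto> v\<close> and
  \<open>p \<mapsto> v \<times> (p - q)\<close> are \<open>h\<close>-related to themselves. An eigenvector of a half turn for the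
  eigenvalue -1 is thereby excluded. The point \<open>q\<close> serves as the origin on the axis. For
  \<open>A \<noteq> mat 1\<close> the axis is unique; for \<open>A = mat 1\<close> it is any line if \<open>a = 0\<close>, and any line
  parallel to \<open>a\<close> otherwise.
\<close>

definition monodromy_axis :: "real^3^3 \<Rightarrow> real^3 \<Rightarrow> real^3 \<Rightarrow> real^3 \<Rightarrow> bool" where
  "monodromy_axis A a v q \<longleftrightarrow>
     norm v = 1 \<and> A *v v = v \<and> cross3 v ((A *v q + a) - q) = 0"

definition arclength_deriv :: "(real \<Rightarrow> real^3) \<Rightarrow> (real \<Rightarrow> real^3) \<Rightarrow> real \<Rightarrow> real^3" where
  "arclength_deriv \<gamma> F x =
     vector_derivative F (at x) /\<^sub>R norm (vector_derivative \<gamma> (at x))"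

definition tangent :: "(real \<Rightarrow> real^3) \<Rightarrow> real \<Rightarrow> real^3" where
  "tangent \<gamma> = arclength_deriv \<gamma> \<gamma>"

function Y_nat :: "(real \<Rightarrow> real^3) \<Rightarrow> nat \<Rightarrow> real \<Rightarrow> real^3" where
  "Y_nat \<gamma> 0 = tangent \<gamma>"
| "Y_nat \<gamma> (Suc k) =
     (\<lambda>x. cross3 (tangent \<gamma> x) (arclength_deriv \<gamma> (Y_nat \<gamma> k) x)
          - ((1/2) * (\<Sum>i\<in>{1..k}. Y_nat \<gamma> i x \<bullet> Y_nat \<gamma> (k - i + 1) x)) *\<^sub>R tangent \<gamma> x)"
  by pat_completeness auto
termination
  by (relation "Wellfounded.measure snd") auto

text \<open>Only the values at indices \<open>k \<ge> -2\<close> are meaningful.\<close>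

definition Y :: "real^3 \<Rightarrow> real^3 \<Rightarrow> (real \<Rightarrow> real^3) \<Rightarrow> int \<Rightarrow> real \<Rightarrow> real^3" where
  "Y v q \<gamma> k x =
     (if k = -2 then cross3 v (\<gamma> x - q)
      else if k = -1 then v
      else Y_nat \<gamma> (nat k) x)"

definition G :: "real^3 \<Rightarrow> real^3 \<Rightarrow> (real \<Rightarrow> real^3) \<Rightarrow> int \<Rightarrow> real \<Rightarrow> real^3" where
  "G v q \<gamma> k x = cross3 (tangent \<gamma> x) (Y v q \<gamma> k x)"

text \<open>\<open>\<gamma>\<close> is \<open>E\<^sub>m\<close> critical under the constraints \<open>E\<^sub>j\<close>, \<open>j \<in> J\<close>.\<close>

definition critical :: "real^3 \<Rightarrow> real^3 \<Rightarrow> (real \<Rightarrow> real^3) \<Rightarrow> int \<Rightarrow> int set \<Rightarrow> bool" where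
  "critical v q \<gamma> m J \<longleftrightarrow>
     (\<exists>c :: int \<Rightarrow> real. \<forall>x. G v q \<gamma> m x = (\<Sum>j\<in>J. c j *\<^sub>R G v q \<gamma> j x))"

text \<open>
  Along \<open>\<gamma>\<close>, the flow \<open>Y\<^sub>m\<close> agrees with the vector field \<open>X\<close> on space modulo a linear
  combination of the lower order flows \<open>Y\<^sub>0, \<dots>, Y\<^bsub>m-1\<^esub>\<close>.
\<close>

definition evolves_by ::
  "real^3 \<Rightarrow> real^3 \<Rightarrow> (real \<Rightarrow> real^3) \<Rightarrow> int \<Rightarrow> (real^3 \<Rightarrow> real^3) \<Rightarrow> bool" where
  "evolves_by v q \<gamma> m X \<longleftrightarrow>
     (\<exists>c :: int \<Rightarrow> real. \<forall>x. Y v q \<gamma> m x = (\<Sum>i\<in>{0..m-1}. c i *\<^sub>R Y v q \<gamma> i x) + X (\<gamma> x))"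

end

theory Submission
  imports Defs
begin

text \<open>
  Write \<open>'\<close> for the arclength derivative. Everything rests on the identity
  \<open>T \<times> Y\<^sub>j\<^sub>+\<^sub>1 = - Y\<^sub>j'\<close>, that is \<open>G\<^sub>j\<^sub>+\<^sub>1 = - Y\<^sub>j'\<close>, for all \<open>j \<ge> -2\<close>
  (\<open>Y_has_vector_derivative\<close>). For the Killing fields it is immediate; for \<open>j \<ge> 0\<close> it amounts to
  \<open>T \<bullet> Y\<^sub>j' = 0\<close> (\<open>tangent_inner_Y_nat_deriv\<close>), which holds because the recursion keeps the
  generating function \<open>\<Sum>j. Y\<^sub>j \<lambda>\<^sup>-\<^sup>j\<close> of unit length.

  The constrained Euler--Lagrange equation \<open>G\<^sub>m = \<Sum>j. c\<^sub>j G\<^sub>j\<close> can then be read in two ways.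
  As an equation between derivatives it integrates to \<open>Y\<^sub>m\<^sub>-\<^sub>1 = \<Sum>j. c\<^sub>j Y\<^sub>j\<^sub>-\<^sub>1 + u\<close> with a
  constant vector \<open>u\<close> (\<open>critical_iff_dependent_mod_constant\<close>). As an equation between cross products
  with \<open>T\<close> it says that \<open>Y\<^sub>m - \<Sum>j. c\<^sub>j Y\<^sub>j\<close> is tangential, and the length-preserving property
  makes it a constant multiple of \<open>Y\<^sub>0 = T\<close> (\<open>critical_iff_dependent\<close>). The first reading of (i)
  is (iv), the second reading of (iii) is (v), and (ii) read both ways shows that (v) implies (ii)
  and (ii) implies (iv). All this works for every choice of the axis.

  Only the way back from (iv) to (v) involves the monodromy. If \<open>Y\<^sub>k\<close> is a constant vector \<open>w\<close> modulo
  lower flows, then \<open>Y\<^sub>k\<^sub>-\<^sub>1\<close> is a Killing field \<open>w \<times> p + u\<close> modulo lower flows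
  (\<open>evolves_by_translation_imp_screw\<close>). The flows are equivariant under the monodromy \<open>h\<close>, so this
  Killing field is \<open>h\<close>-related to itself (\<open>translation_flow_monodromy\<close>). If \<open>h\<close> has a rotational
  part, this forces a screw motion about its axis (\<open>invariant_Killing_field_about_axis\<close>). If \<open>h\<close> is a
  translation by \<open>a\<close>, it forces \<open>w \<times> a = 0\<close>, and if \<open>w = 0\<close> the same argument one order lower gives
  \<open>u \<times> a = 0\<close>; so the axis of the Killing field is also an axis of \<open>h\<close>
  (\<open>translation_flow_imp_screw_about_some_axis\<close>).
\<close>


section \<open>Smooth functions of a real variable\<close>

text \<open>
  Smoothness quantifies over all iterated derivatives at once. Counting derivatives turns
  closure properties into inductions on the count, in which the function varies.
\<close>

primrec differentiable_times :: "nat \<Rightarrow> (real \<Rightarrow> 'a::real_normed_vector) \<Rightarrow> bool" where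
  "differentiable_times 0 f \<longleftrightarrow> True"
| "differentiable_times (Suc n) f \<longleftrightarrow>
     (\<forall>x. f differentiable at x) \<and> differentiable_times n (\<lambda>x. vector_derivative f (at x))"

lemma differentiable_times_iff:
  "differentiable_times n f \<longleftrightarrow>
     (\<forall>m<n. \<forall>x. ((\<lambda>g y. vector_derivative g (at y)) ^^ m) f differentiable (at x))"
proof (induction n arbitrary: f)
  case 0
  show ?case by simp
next
  case (Suc n)
  show ?case
    by (simp add: Suc.IH All_less_Suc2 funpow_Suc_right del: funpow.simps)
qed

lemma smooth_iff: "smooth f \<longleftrightarrow> (\<forall>n. differentiable_times n f)"
  unfolding smooth_def differentiable_times_iff by auto

lemma differentiable_times_SucD: "differentiable_times (Suc n) f \<Longrightarrow> differentiable_times n f"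
  unfolding differentiable_times_iff by simp

lemma differentiable_times_SucI:
  assumes "\<And>x. (f has_vector_derivative f' x) (at x)" and "differentiable_times n f'"
  shows "differentiable_times (Suc n) f"
proof -
  have "(\<lambda>x. vector_derivative f (at x)) = f'"
    using vector_derivative_at[OF assms(1)] by auto
  then show ?thesis
    using assms differentiableI_vector by auto
qed

lemma smooth_imp_has_vector_derivative:
  assumes "smooth f"
  shows "(f has_vector_derivative vector_derivative f (at x)) (at x)"
proof -
  have "differentiable_times (Suc 0) f"
    using assms smooth_iff by blast
  then show ?thesis
    by (simp add: vector_derivative_works)
qed

lemma smooth_vector_derivative:
  assumes "smooth f"
  shows "smooth (\<lambda>x. vector_derivative f (at x))"
  unfolding smooth_iff
proof
  fix n
  have "differentiable_times (Suc n) f"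
    using assms smooth_iff by blast
  then show "differentiable_times n (\<lambda>x. vector_derivative f (at x))"
    by simp
qed

lemma differentiable_times_const: "differentiable_times n (\<lambda>x. c)"
proof (induction n arbitrary: c)
  case (Suc n)
  show ?case
    by (rule differentiable_times_SucI[OF has_vector_derivative_const Suc.IH])
qed simp

lemma differentiable_times_add:
  assumes "differentiable_times n f" and "differentiable_times n g"
  shows "differentiable_times n (\<lambda>x. f x + g x)"
  using assms
proof (induction n arbitrary: f g)
  case (Suc n)
  show ?case
    by (rule differentiable_times_SucI[OF has_vector_derivative_add Suc.IH])
       (use Suc.prems in \<open>auto simp: vector_derivative_works\<close>)
qed simp

lemma differentiable_times_bilinear:
  assumes "bounded_bilinear B" and "differentiable_times n f" and "differentiable_times n g"
  shows "differentiable_times n (\<lambda>x. B (f x) (g x))"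
  using assms(2,3)
proof (induction n arbitrary: f g)
  case (Suc n)
  let ?f' = "\<lambda>x. vector_derivative f (at x)" and ?g' = "\<lambda>x. vector_derivative g (at x)"
  have "((\<lambda>x. B (f x) (g x)) has_vector_derivative B (f x) (?g' x) + B (?f' x) (g x)) (at x)" for x
    by (rule bounded_bilinear.has_vector_derivative[OF assms(1)])
       (use Suc.prems in \<open>auto simp: vector_derivative_works\<close>)
  moreover have "differentiable_times n (\<lambda>x. B (f x) (?g' x) + B (?f' x) (g x))"
    by (intro differentiable_times_add Suc.IH differentiable_times_SucD[OF Suc.prems(1)]
          differentiable_times_SucD[OF Suc.prems(2)])
       (use Suc.prems in auto)
  ultimately show ?case
    by (rule differentiable_times_SucI)
qed simp

lemma smooth_const: "smooth (\<lambda>x. c)"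
  by (simp add: smooth_iff differentiable_times_const)

lemma smooth_add: "smooth f \<Longrightarrow> smooth g \<Longrightarrow> smooth (\<lambda>x. f x + g x)"
  by (simp add: smooth_iff differentiable_times_add)

lemma smooth_bilinear:
  "bounded_bilinear B \<Longrightarrow> smooth f \<Longrightarrow> smooth g \<Longrightarrow> smooth (\<lambda>x. B (f x) (g x))"
  by (simp add: smooth_iff differentiable_times_bilinear)

lemma smooth_diff:
  assumes "smooth f" and "smooth g"
  shows "smooth (\<lambda>x. f x - g x)"
  using smooth_add[OF assms(1) smooth_bilinear[OF bounded_bilinear_scaleR smooth_const[of "-1"] assms(2)]]
  by simp

lemma smooth_sum: "(\<And>i. i \<in> I \<Longrightarrow> smooth (f i)) \<Longrightarrow> smooth (\<lambda>x. \<Sum>i\<in>I. f i x)"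
  by (induction I rule: infinite_finite_induct) (auto simp: smooth_const smooth_add)

lemma bounded_bilinear_cross3: "bounded_bilinear cross3"
  using bilinear_conv_bounded_bilinear bilinear_cross by blast

text \<open>
  The derivative of \<open>h = 1 / |g|\<close> is \<open>- (g \<bullet> g') h\<^sup>3\<close>, a product of \<open>h\<close> with smooth functions.
  Hence \<open>h\<close> gains one derivative at each step of an induction.
\<close>

lemma smooth_inverse_norm:
  fixes g :: "real \<Rightarrow> 'a::real_inner"
  assumes g: "smooth g" and nonzero: "\<And>x. g x \<noteq> 0"
  shows "smooth (\<lambda>x. inverse (norm (g x)))"
  unfolding smooth_iff
proof
  let ?h = "\<lambda>x. inverse (norm (g x))" and ?g' = "\<lambda>x. vector_derivative g (at x)"
  let ?h' = "\<lambda>x. (- 1) * ((g x \<bullet> ?g' x) * (?h x * (?h x * ?h x)))"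
  have deriv: "(?h has_vector_derivative ?h' x) (at x)" for x
  proof -
    have "((\<lambda>x. g x \<bullet> g x) has_real_derivative 2 * (g x \<bullet> ?g' x)) (at x)"
      using bounded_bilinear.has_vector_derivative[OF bounded_bilinear_inner
          smooth_imp_has_vector_derivative[OF g] smooth_imp_has_vector_derivative[OF g]]
      by (simp add: has_real_derivative_iff_has_vector_derivative inner_commute)
    moreover have "g x \<bullet> g x > 0"
      using nonzero by simp
    ultimately have "((\<lambda>x. inverse (sqrt (g x \<bullet> g x))) has_real_derivative ?h' x) (at x)"
      using nonzero[of x]
      by (auto intro!: derivative_eq_intros simp: norm_eq_sqrt_inner field_simps simp del: inner_gt_zero_iff)
    then show ?thesis
      by (simp add: norm_eq_sqrt_inner has_real_derivative_iff_has_vector_derivative)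
  qed
  fix n
  show "differentiable_times n ?h"
  proof (induction n)
    case (Suc n)
    have "differentiable_times n (\<lambda>x. g x \<bullet> ?g' x)"
      using smooth_bilinear[OF bounded_bilinear_inner g smooth_vector_derivative[OF g]]
      by (simp add: smooth_iff)
    then have "differentiable_times n ?h'"
      by (intro differentiable_times_bilinear[OF bounded_bilinear_mult] Suc.IH
          differentiable_times_const)
    with deriv show ?case
      by (rule differentiable_times_SucI)
  qed simp
qed

lemma cross_inner_skew: "cross3 a b \<bullet> c = - (cross3 a c \<bullet> b)"
  by (simp add: cross_triple[of a b] cross_triple[of a c] cross_skew[of b c])

lemma constant_if_vector_derivative_zero:
  fixes f :: "real \<Rightarrow> 'a::real_normed_vector"
  assumes "\<And>x. (f has_vector_derivative 0) (at x)"
  obtains c where "\<And>x. f x = c"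
  using has_derivative_zero_constant[of UNIV f] assms
  by (auto simp: has_vector_derivative_def)


section \<open>The hierarchy along an immersed curve\<close>

(* The indices \<open>k - i + 1\<close> in the recursion match its own left-hand side: rewriting with it
   automatically would not end. *)
declare Y_nat.simps(2) [simp del]

locale immersed_curve =
  fixes \<gamma> :: "real \<Rightarrow> real^3"
  assumes smooth_curve: "smooth \<gamma>"
    and regular: "\<And>x. vector_derivative \<gamma> (at x) \<noteq> 0"
begin

abbreviation speed :: "real \<Rightarrow> real" where
  "speed x \<equiv> norm (vector_derivative \<gamma> (at x))"

abbreviation T :: "real \<Rightarrow> real^3" where
  "T \<equiv> tangent \<gamma>"

abbreviation D :: "(real \<Rightarrow> real^3) \<Rightarrow> real \<Rightarrow> real^3" where
  "D \<equiv> arclength_deriv \<gamma>"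

lemma has_arclength_derivative:
  assumes "smooth F"
  shows "(F has_vector_derivative speed x *\<^sub>R D F x) (at x)"
  using smooth_imp_has_vector_derivative[OF assms, of x] regular[of x]
  by (simp add: arclength_deriv_def)

lemma has_tangent: "(\<gamma> has_vector_derivative speed x *\<^sub>R T x) (at x)"
  using has_arclength_derivative[OF smooth_curve] by (simp add: tangent_def)

lemma tangent_unit: "T x \<bullet> T x = 1"
  using regular[of x] by (simp add: tangent_def arclength_deriv_def dot_square_norm power2_eq_square)

lemma smooth_arclength_deriv:
  assumes "smooth F"
  shows "smooth (D F)"
  using smooth_bilinear[OF bounded_bilinear_scaleR
      smooth_inverse_norm[OF smooth_vector_derivative[OF smooth_curve] regular]
      smooth_vector_derivative[OF assms]]
  by (simp add: arclength_deriv_def[abs_def])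

lemma smooth_tangent: "smooth T"
  unfolding tangent_def by (rule smooth_arclength_deriv[OF smooth_curve])

lemma smooth_Y_nat: "smooth (Y_nat \<gamma> n)"
proof (induction n rule: less_induct)
  case (less n)
  show ?case
  proof (cases n)
    case 0
    then show ?thesis by (simp add: smooth_tangent)
  next
    case (Suc k)
    have "smooth (\<lambda>x. cross3 (T x) (D (Y_nat \<gamma> k) x)
        - ((1/2) * (\<Sum>i\<in>{1..k}. Y_nat \<gamma> i x \<bullet> Y_nat \<gamma> (k - i + 1) x)) *\<^sub>R T x)"
      by (intro smooth_diff smooth_bilinear[OF bounded_bilinear_cross3] smooth_sum
          smooth_bilinear[OF bounded_bilinear_scaleR] smooth_bilinear[OF bounded_bilinear_mult]
          smooth_bilinear[OF bounded_bilinear_inner] smooth_const smooth_tangent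
          smooth_arclength_deriv less.IH) (use Suc in auto)
    then show ?thesis unfolding Suc Y_nat.simps(2) .
  qed
qed

text \<open>
  The tangential part of the recursion is chosen exactly so that the generating function
  \<open>\<Sum>k. Y\<^sub>k \<lambda>\<^sup>-\<^sup>k\<close> has constant square \<open>1\<close>; the sums below are the
  higher coefficients of that square.
\<close>

lemma sum_inner_Y_nat_eq_zero:
  "(\<Sum>i\<le>Suc k. Y_nat \<gamma> i x \<bullet> Y_nat \<gamma> (Suc k - i) x) = 0"
proof -
  let ?f = "\<lambda>i. Y_nat \<gamma> i x \<bullet> Y_nat \<gamma> (Suc k - i) x"
  have "(\<Sum>i\<in>{1..k}. Y_nat \<gamma> i x \<bullet> Y_nat \<gamma> (k - i + 1) x) = (\<Sum>i\<in>{1..k}. ?f i)"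
    by (intro sum.cong) (auto simp: Suc_diff_le)
  then have *: "T x \<bullet> Y_nat \<gamma> (Suc k) x = - (1/2) * (\<Sum>i\<in>{1..k}. ?f i)"
    unfolding Y_nat.simps(2)
    by (simp add: inner_diff_right dot_cross_self tangent_unit)
  have "{..Suc k} = insert 0 (insert (Suc k) {1..k})"
    by auto
  then have "(\<Sum>i\<le>Suc k. ?f i) = ?f 0 + (?f (Suc k) + (\<Sum>i\<in>{1..k}. ?f i))"
    by (simp del: sum.atMost_Suc)
  then show ?thesis
    using * by (simp add: inner_commute)
qed

lemma inner_Y_nat_deriv_sum:
  assumes "n \<ge> 1"
  shows "(\<Sum>i\<le>n. D (Y_nat \<gamma> i) x \<bullet> Y_nat \<gamma> (n - i) x) = 0"
proof -
  define p where "p = (\<lambda>x. \<Sum>i\<le>n. Y_nat \<gamma> i x \<bullet> Y_nat \<gamma> (n - i) x)"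
  have "p = (\<lambda>x. 0)"
    using sum_inner_Y_nat_eq_zero[where k = "n - 1"] assms by (simp add: p_def del: sum.atMost_Suc)
  let ?a = "\<lambda>i j. Y_nat \<gamma> i x \<bullet> D (Y_nat \<gamma> j) x"
  have "(p has_vector_derivative (\<Sum>i\<le>n. Y_nat \<gamma> i x \<bullet> (speed x *\<^sub>R D (Y_nat \<gamma> (n - i)) x)
      + (speed x *\<^sub>R D (Y_nat \<gamma> i) x) \<bullet> Y_nat \<gamma> (n - i) x)) (at x)"
    unfolding p_def
    by (intro has_vector_derivative_sum
        bounded_bilinear.has_vector_derivative[OF bounded_bilinear_inner]
        has_arclength_derivative smooth_Y_nat)
  moreover have "(p has_vector_derivative 0) (at x)"
    by (simp add: \<open>p = (\<lambda>x. 0)\<close>)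
  ultimately have "(\<Sum>i\<le>n. Y_nat \<gamma> i x \<bullet> (speed x *\<^sub>R D (Y_nat \<gamma> (n - i)) x)
      + (speed x *\<^sub>R D (Y_nat \<gamma> i) x) \<bullet> Y_nat \<gamma> (n - i) x) = 0"
    by (rule vector_derivative_unique_at)
  then have "speed x * ((\<Sum>i\<le>n. ?a i (n - i)) + (\<Sum>i\<le>n. ?a (n - i) i)) = 0"
    by (simp add: sum.distrib sum_distrib_left distrib_left inner_commute)
  moreover have "(\<Sum>i\<le>n. ?a i (n - i)) = (\<Sum>i\<le>n. ?a (n - i) i)"
    by (rule sum.reindex_bij_witness[where i="\<lambda>i. n - i" and j="\<lambda>i. n - i"]) auto
  ultimately show ?thesis
    using regular[of x] by (simp add: inner_commute)
qed

lemma cross_Y_nat_Suc: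
  assumes "T x \<bullet> D (Y_nat \<gamma> k) x = 0"
  shows "cross3 (T x) (Y_nat \<gamma> (Suc k) x) = - D (Y_nat \<gamma> k) x"
  using assms unfolding Y_nat.simps(2)
  by (simp add: Cross3.right_diff_distrib cross_mult_right Lagrange tangent_unit)

text \<open>
  No flow of the hierarchy stretches the curve. In the differentiated square of the generating
  function, all terms but \<open>T \<bullet> Y\<^sub>k'\<close> are, by induction, determinants of \<open>T\<close> with two fields
  \<open>Y\<^sub>i\<close>, \<open>Y\<^sub>j\<close>; they cancel in pairs.
\<close>

lemma tangent_inner_Y_nat_deriv: "T x \<bullet> D (Y_nat \<gamma> k) x = 0"
proof (induction k rule: less_induct)
  case (less k)
  show ?case
  proof (cases "k = 0")
    case True
    have "((\<lambda>x. T x \<bullet> T x) has_vector_derivative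
        T x \<bullet> (speed x *\<^sub>R D T x) + (speed x *\<^sub>R D T x) \<bullet> T x) (at x)"
      by (intro bounded_bilinear.has_vector_derivative[OF bounded_bilinear_inner]
          has_arclength_derivative smooth_tangent)
    moreover have "((\<lambda>x. T x \<bullet> T x) has_vector_derivative 0) (at x)"
      by (simp add: tangent_unit)
    ultimately have "T x \<bullet> (speed x *\<^sub>R D T x) + (speed x *\<^sub>R D T x) \<bullet> T x = 0"
      by (rule vector_derivative_unique_at)
    then show ?thesis
      using True regular[of x] by (simp add: inner_commute)
  next
    case False
    let ?d = "\<lambda>i. cross3 (T x) (Y_nat \<gamma> (Suc i) x) \<bullet> Y_nat \<gamma> (k - i) x"
    have "D (Y_nat \<gamma> i) x \<bullet> Y_nat \<gamma> (k - i) x = - ?d i" if "i < k" for i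
      using cross_Y_nat_Suc[OF less.IH[OF that]] by simp
    then have "(\<Sum>i<k. D (Y_nat \<gamma> i) x \<bullet> Y_nat \<gamma> (k - i) x) = - (\<Sum>i<k. ?d i)"
      by (simp add: sum_negf)
    moreover have "(\<Sum>i<k. ?d i) = 0"
    proof -
      have "?d (k - Suc i) = - ?d i" if "i < k" for i
        using that cross_inner_skew[of "T x" "Y_nat \<gamma> (k - i) x"] by (simp add: Suc_diff_Suc)
      then have "(\<Sum>i<k. ?d (k - Suc i)) = - (\<Sum>i<k. ?d i)"
        by (simp add: sum_negf)
      then show ?thesis
        using sum.nat_diff_reindex[of ?d k] by simp
    qed
    moreover have "(\<Sum>i<k. D (Y_nat \<gamma> i) x \<bullet> Y_nat \<gamma> (k - i) x) + D (Y_nat \<gamma> k) x \<bullet> T x = 0"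
      using inner_Y_nat_deriv_sum[of k x] False
      by (simp add: lessThan_Suc_atMost[symmetric])
    ultimately show ?thesis
      by (simp add: inner_commute)
  qed
qed


lemma Y_zero: "Y v q \<gamma> 0 = T"
  by (auto simp: Y_def)

lemma Y_nonneg: "j \<ge> 0 \<Longrightarrow> Y v q \<gamma> j = Y_nat \<gamma> (nat j)"
  by (auto simp: Y_def)

lemma tangent_inner_G: "T x \<bullet> G v q \<gamma> j x = 0"
  by (simp add: G_def dot_cross_self)

text \<open>
  The relation \<open>G\<^sub>j\<^sub>+\<^sub>1 = - Y\<^sub>j'\<close> also holds below the tangent field, which makes the two
  Killing fields the natural start of the hierarchy.
\<close>

lemma Y_has_vector_derivative:
  assumes "j \<ge> -2"
  shows "(Y v q \<gamma> j has_vector_derivative - (speed x *\<^sub>R G v q \<gamma> (j + 1) x)) (at x)"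
proof -
  consider "j = -2" | "j = -1" | "j \<ge> 0"
    using assms by linarith
  then show ?thesis
  proof cases
    case 1
    have "((\<lambda>x. cross3 v (\<gamma> x - q)) has_vector_derivative
        cross3 v (speed x *\<^sub>R T x - 0) + cross3 0 (\<gamma> x - q)) (at x)"
      by (intro bounded_bilinear.has_vector_derivative[OF bounded_bilinear_cross3]
          has_vector_derivative_diff has_vector_derivative_const has_tangent)
    moreover have "Y v q \<gamma> j = (\<lambda>x. cross3 v (\<gamma> x - q))"
      using 1 by (auto simp: Y_def)
    ultimately show ?thesis
      using 1 cross_skew[of v "T x"] by (simp add: G_def Y_def cross_mult_right)
  next
    case 2
    then have "Y v q \<gamma> j = (\<lambda>x. v)" and "G v q \<gamma> (j + 1) x = 0"
      by (auto simp: Y_def G_def)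
    then show ?thesis by simp
  next
    case 3
    then have "G v q \<gamma> (j + 1) x = - D (Y_nat \<gamma> (nat j)) x"
      using cross_Y_nat_Suc[OF tangent_inner_Y_nat_deriv[of x "nat j"]]
      by (simp add: G_def Y_def nat_add_distrib)
    then show ?thesis
      using has_arclength_derivative[OF smooth_Y_nat, of "nat j" x] 3 by (simp add: Y_nonneg)
  qed
qed

lemma Y_combination_has_vector_derivative:
  assumes "m \<ge> -2" and "J \<subseteq> {-2..}"
  shows "((\<lambda>x. Y v q \<gamma> m x - (\<Sum>j\<in>J. c j *\<^sub>R Y v q \<gamma> j x)) has_vector_derivative
    - (speed x *\<^sub>R (G v q \<gamma> (m + 1) x - (\<Sum>j\<in>J. c j *\<^sub>R G v q \<gamma> (j + 1) x)))) (at x)"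
proof -
  have "((\<lambda>x. Y v q \<gamma> m x - (\<Sum>j\<in>J. c j *\<^sub>R Y v q \<gamma> j x)) has_vector_derivative
     - (speed x *\<^sub>R G v q \<gamma> (m + 1) x) -
       (\<Sum>j\<in>J. c j *\<^sub>R - (speed x *\<^sub>R G v q \<gamma> (j + 1) x))) (at x)"
    by (intro has_vector_derivative_diff has_vector_derivative_sum Y_has_vector_derivative
        bounded_linear.has_vector_derivative[OF bounded_linear_scaleR_right])
       (use assms in auto)
  then show ?thesis
    by (simp add: sum_negf scaleR_sum_right scaleR_diff_right mult.commute)
qed


section \<open>Criticality as linear dependence of flows\<close>

text \<open>
  The Lagrange multipliers survive the integration unchanged, shifted by one index. Keeping
  track of them is what preserves the vector \<open>w\<close> in \<open>evolves_by_translation_imp_screw\<close>.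
\<close>

lemma G_dependence_iff:
  assumes "m \<ge> -2" and "J \<subseteq> {-2..}"
  shows "(\<forall>x. G v q \<gamma> (m + 1) x = (\<Sum>j\<in>J. c j *\<^sub>R G v q \<gamma> (j + 1) x)) \<longleftrightarrow>
    (\<exists>u. \<forall>x. Y v q \<gamma> m x = (\<Sum>j\<in>J. c j *\<^sub>R Y v q \<gamma> j x) + u)" (is "?L \<longleftrightarrow> ?R")
proof
  let ?W = "\<lambda>x. Y v q \<gamma> m x - (\<Sum>j\<in>J. c j *\<^sub>R Y v q \<gamma> j x)"
  note deriv = Y_combination_has_vector_derivative[OF assms, of v q c]
  show ?R if ?L
  proof -
    have "(?W has_vector_derivative 0) (at x)" for x
      using deriv[of x] that by simp
    from constant_if_vector_derivative_zero[OF this] obtain u where "\<And>x. ?W x = u"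
      by blast
    then have "Y v q \<gamma> m x = (\<Sum>j\<in>J. c j *\<^sub>R Y v q \<gamma> j x) + u" for x
      by (simp add: diff_eq_eq add.commute)
    then show ?R
      by blast
  qed
  show ?L if ?R
  proof
    fix x
    obtain u where "\<And>x. Y v q \<gamma> m x = (\<Sum>j\<in>J. c j *\<^sub>R Y v q \<gamma> j x) + u"
      using \<open>?R\<close> by blast
    then have "?W = (\<lambda>x. u)"
      by (intro ext) (simp add: diff_eq_eq add.commute)
    then have "(?W has_vector_derivative 0) (at x)"
      by simp
    then have "- (speed x *\<^sub>R (G v q \<gamma> (m + 1) x - (\<Sum>j\<in>J. c j *\<^sub>R G v q \<gamma> (j + 1) x))) = 0"
      using vector_derivative_unique_at[OF deriv] by blast
    then show "G v q \<gamma> (m + 1) x = (\<Sum>j\<in>J. c j *\<^sub>R G v q \<gamma> (j + 1) x)"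
      using regular[of x] by simp
  qed
qed

text \<open>
  The first of two readings of the Euler--Lagrange equation: integrated once, it expresses a
  flow through lower ones up to a constant vector.
\<close>

lemma critical_iff_dependent_mod_constant:
  assumes "m \<ge> -1" and "l \<ge> -1"
  shows "critical v q \<gamma> m {l..n} \<longleftrightarrow>
    (\<exists>c u. \<forall>x. Y v q \<gamma> (m - 1) x = (\<Sum>j\<in>{l-1..n-1}. c j *\<^sub>R Y v q \<gamma> j x) + u)"
proof -
  have shift: "(\<Sum>j\<in>{l..n}. c j *\<^sub>R G v q \<gamma> j x) =
      (\<Sum>j\<in>{l-1..n-1}. c (j + 1) *\<^sub>R G v q \<gamma> (j + 1) x)" for c x
    by (rule sum.reindex_bij_witness[where i = "\<lambda>j. j + 1" and j = "\<lambda>j. j - 1"]) auto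
  have "critical v q \<gamma> m {l..n} \<longleftrightarrow>
      (\<exists>c. \<forall>x. G v q \<gamma> m x = (\<Sum>j\<in>{l-1..n-1}. c j *\<^sub>R G v q \<gamma> (j + 1) x))"
    unfolding critical_def shift
  proof safe
    fix c
    assume "\<forall>x. G v q \<gamma> m x = (\<Sum>j\<in>{l-1..n-1}. c j *\<^sub>R G v q \<gamma> (j + 1) x)"
    then show "\<exists>c. \<forall>x. G v q \<gamma> m x = (\<Sum>j\<in>{l-1..n-1}. c (j + 1) *\<^sub>R G v q \<gamma> (j + 1) x)"
      by (intro exI[of _ "\<lambda>j. c (j - 1)"]) simp
  next
    fix c
    assume "\<forall>x. G v q \<gamma> m x = (\<Sum>j\<in>{l-1..n-1}. c (j + 1) *\<^sub>R G v q \<gamma> (j + 1) x)"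
    then show "\<exists>c. \<forall>x. G v q \<gamma> m x = (\<Sum>j\<in>{l-1..n-1}. c j *\<^sub>R G v q \<gamma> (j + 1) x)"
      by (intro exI[of _ "\<lambda>j. c (j + 1)"])
  qed
  also have "\<dots> \<longleftrightarrow> (\<exists>c u. \<forall>x. Y v q \<gamma> (m - 1) x = (\<Sum>j\<in>{l-1..n-1}. c j *\<^sub>R Y v q \<gamma> j x) + u)"
    using G_dependence_iff[of "m - 1" "{l-1..n-1}" v q] assms by simp
  finally show ?thesis .
qed

lemma parallel_to_tangent:
  assumes deriv: "\<And>x. (W has_vector_derivative W' x) (at x)"
    and orth: "\<And>x. T x \<bullet> W' x = 0" and parallel: "\<And>x. cross3 (T x) (W x) = 0"
  obtains b where "\<And>x. W x = b *\<^sub>R T x"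
proof -
  have W: "W x = (T x \<bullet> W x) *\<^sub>R T x" for x
    using Lagrange[of "T x" "T x" "W x"] parallel[of x] by (simp add: tangent_unit)
  have "T x \<bullet> D T x = 0" for x
    using tangent_inner_Y_nat_deriv[of x 0] by simp
  then have "D T x \<bullet> W x = 0" for x
    by (subst W) (simp add: inner_commute)
  moreover have "((\<lambda>x. T x \<bullet> W x) has_vector_derivative
      T x \<bullet> W' x + (speed x *\<^sub>R D T x) \<bullet> W x) (at x)" for x
    by (intro bounded_bilinear.has_vector_derivative[OF bounded_bilinear_inner]
        has_arclength_derivative smooth_tangent deriv)
  ultimately have "((\<lambda>x. T x \<bullet> W x) has_vector_derivative 0) (at x)" for x
    by (simp add: orth)
  from constant_if_vector_derivative_zero[OF this] obtain b where "\<And>x. T x \<bullet> W x = b"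
    by blast
  then show thesis
    using W that by metis
qed

lemma cross_tangent_Y_combination:
  "cross3 (T x) (\<Sum>j\<in>J. c j *\<^sub>R Y v q \<gamma> j x) = (\<Sum>j\<in>J. c j *\<^sub>R G v q \<gamma> j x)"
  by (simp add: G_def bounded_bilinear.sum_right[OF bounded_bilinear_cross3] cross_mult_right)

text \<open>
  The second reading: without integration, the Euler--Lagrange equation says that a combination
  of flows is tangential. Since flows do not stretch the curve, the combination is then a constant
  multiple of \<open>Y\<^sub>0 = T\<close>, which is absorbed into the coefficient at \<open>0 \<in> J\<close>.
\<close>

lemma critical_iff_dependent:
  assumes "m \<ge> -2" and "J \<subseteq> {-2..}" and "finite J" and "0 \<in> J"
  shows "critical v q \<gamma> m J \<longleftrightarrow> (\<exists>c. \<forall>x. Y v q \<gamma> m x = (\<Sum>j\<in>J. c j *\<^sub>R Y v q \<gamma> j x))"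
proof
  assume "critical v q \<gamma> m J"
  then obtain c where c: "\<And>x. G v q \<gamma> m x = (\<Sum>j\<in>J. c j *\<^sub>R G v q \<gamma> j x)"
    unfolding critical_def by blast
  let ?W = "\<lambda>x. Y v q \<gamma> m x - (\<Sum>j\<in>J. c j *\<^sub>R Y v q \<gamma> j x)"
  obtain b where b: "\<And>x. ?W x = b *\<^sub>R T x"
  proof (rule parallel_to_tangent[OF Y_combination_has_vector_derivative[OF assms(1,2)]])
    show "cross3 (T x) (?W x) = 0" for x
      using c[of x] by (simp add: Cross3.right_diff_distrib cross_tangent_Y_combination G_def[of v q \<gamma> m])
  qed (auto simp: inner_diff_right inner_sum_right tangent_inner_G)
  have "Y v q \<gamma> m x = (\<Sum>j\<in>J. (c(0 := c 0 + b)) j *\<^sub>R Y v q \<gamma> j x)" for x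
  proof -
    have "Y v q \<gamma> m x = (\<Sum>j\<in>J. c j *\<^sub>R Y v q \<gamma> j x) + b *\<^sub>R T x"
      using b[of x] by (simp add: algebra_simps)
    then show ?thesis
      using assms(3,4) by (simp add: sum.remove[of J 0] Y_zero scaleR_add_left)
  qed
  then show "\<exists>c. \<forall>x. Y v q \<gamma> m x = (\<Sum>j\<in>J. c j *\<^sub>R Y v q \<gamma> j x)"
    by blast
next
  assume "\<exists>c. \<forall>x. Y v q \<gamma> m x = (\<Sum>j\<in>J. c j *\<^sub>R Y v q \<gamma> j x)"
  then show "critical v q \<gamma> m J"
    unfolding critical_def G_def[of v q \<gamma> m] by (auto simp: cross_tangent_Y_combination)
qed

lemma sum_with_Killing_fields:
  assumes "m \<ge> 0"
  shows "(\<Sum>j\<in>{-2..m-1}. c j *\<^sub>R Y v q \<gamma> j x) = (\<Sum>j\<in>{0..m-1}. c j *\<^sub>R Y v q \<gamma> j x)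
    + (c (-2) *\<^sub>R cross3 v (\<gamma> x - q) + c (-1) *\<^sub>R v)"
proof -
  have "{-2..m-1} = insert (-2) (insert (-1) {0..m-1})"
    using assms by auto
  then show ?thesis
    by (simp add: Y_def[of v q \<gamma> "-2"] Y_def[of v q \<gamma> "-1"])
qed

lemma sum_with_translation:
  assumes "m \<ge> 0"
  shows "(\<Sum>j\<in>{-1..m-1}. c j *\<^sub>R Y v q \<gamma> j x) = (\<Sum>j\<in>{0..m-1}. c j *\<^sub>R Y v q \<gamma> j x)
    + c (-1) *\<^sub>R v"
proof -
  have "{-1..m-1} = insert (-1) {0..m-1}"
    using assms by auto
  then show ?thesis
    by (simp add: Y_def[of v q \<gamma> "-1"])
qed

lemma evolves_by_Killing_field_iff:
  assumes "m \<ge> 0"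
  shows "(\<exists>\<alpha> \<beta>. evolves_by v q \<gamma> m (\<lambda>p. \<alpha> *\<^sub>R cross3 v (p - q) + \<beta> *\<^sub>R v)) \<longleftrightarrow>
    (\<exists>c. \<forall>x. Y v q \<gamma> m x = (\<Sum>j\<in>{-2..m-1}. c j *\<^sub>R Y v q \<gamma> j x))"
proof safe
  fix \<alpha> \<beta>
  assume "evolves_by v q \<gamma> m (\<lambda>p. \<alpha> *\<^sub>R cross3 v (p - q) + \<beta> *\<^sub>R v)"
  then obtain c where "\<And>x. Y v q \<gamma> m x = (\<Sum>j\<in>{0..m-1}. c j *\<^sub>R Y v q \<gamma> j x)
      + (\<alpha> *\<^sub>R cross3 v (\<gamma> x - q) + \<beta> *\<^sub>R v)"
    unfolding evolves_by_def by blast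
  then show "\<exists>c. \<forall>x. Y v q \<gamma> m x = (\<Sum>j\<in>{-2..m-1}. c j *\<^sub>R Y v q \<gamma> j x)"
    by (intro exI[of _ "c(-2 := \<alpha>, -1 := \<beta>)"]) (simp add: sum_with_Killing_fields[OF assms])
next
  fix c
  assume "\<forall>x. Y v q \<gamma> m x = (\<Sum>j\<in>{-2..m-1}. c j *\<^sub>R Y v q \<gamma> j x)"
  then show "\<exists>\<alpha> \<beta>. evolves_by v q \<gamma> m (\<lambda>p. \<alpha> *\<^sub>R cross3 v (p - q) + \<beta> *\<^sub>R v)"
    unfolding evolves_by_def sum_with_Killing_fields[OF assms] by blast
qed

lemma evolves_by_axis_independent:
  assumes "m \<ge> 0"
  shows "evolves_by v q \<gamma> m X \<longleftrightarrow> evolves_by v' q' \<gamma> m X"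
proof -
  have "(\<Sum>i\<in>{0..m-1}. c i *\<^sub>R Y v q \<gamma> i x) = (\<Sum>i\<in>{0..m-1}. c i *\<^sub>R Y v' q' \<gamma> i x)" for c x
    by (intro sum.cong) (auto simp: Y_nonneg)
  then show ?thesis
    unfolding evolves_by_def by (simp add: Y_nonneg[OF assms])
qed

lemma critical_iff_evolves_by_translation:
  assumes "k \<ge> 1"
  shows "critical v q \<gamma> (k + 1) {1..k} \<longleftrightarrow> (\<exists>w. evolves_by v q \<gamma> k (\<lambda>p. w))"
  using critical_iff_dependent_mod_constant[of "k + 1" 1 v q k] assms
  unfolding evolves_by_def by auto

text \<open>
  The translation obtained here is a multiple of \<open>v\<close>. A flow that evolves by some other translation
  need not be critical for this axis, so there is no converse for fixed \<open>v\<close>.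
\<close>

lemma critical_imp_evolves_by_translation:
  assumes "k \<ge> 1" and "critical v q \<gamma> k {-1..k-1}"
  shows "\<exists>w. evolves_by v q \<gamma> k (\<lambda>p. w)"
proof -
  obtain c where "\<And>x. Y v q \<gamma> k x = (\<Sum>j\<in>{-1..k-1}. c j *\<^sub>R Y v q \<gamma> j x)"
    using assms critical_iff_dependent[of k "{-1..k-1}" v q] by fastforce
  then have "\<forall>x. Y v q \<gamma> k x = (\<Sum>j\<in>{0..k-1}. c j *\<^sub>R Y v q \<gamma> j x) + c (-1) *\<^sub>R v"
    using assms by (simp add: sum_with_translation)
  then show ?thesis
    unfolding evolves_by_def by blast
qed

text \<open>
  The bound on \<open>k\<close> puts \<open>0\<close> among the constraints, as needed to absorb the tangential part.
\<close>

lemma critical_iff_evolves_by_Killing_field: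
  assumes "k \<ge> 2"
  shows "critical v q \<gamma> (k - 1) {-2..k-2} \<longleftrightarrow>
    (\<exists>\<alpha> \<beta>. evolves_by v q \<gamma> (k - 1) (\<lambda>p. \<alpha> *\<^sub>R cross3 v (p - q) + \<beta> *\<^sub>R v))"
  using assms critical_iff_dependent[of "k - 1" "{-2..k-2}" v q]
    evolves_by_Killing_field_iff[of "k - 1" v q]
  by auto

text \<open>
  Differentiating the expression for \<open>Y\<^sub>k\<^sub>-\<^sub>1\<close> turns the rotational part into a multiple of
  \<open>G\<^sub>-\<^sub>1\<close> and removes the translational part.
\<close>

lemma evolves_by_Killing_field_imp_critical:
  assumes "k \<ge> 1"
    and "\<exists>\<alpha> \<beta>. evolves_by v q \<gamma> (k - 1) (\<lambda>p. \<alpha> *\<^sub>R cross3 v (p - q) + \<beta> *\<^sub>R v)"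
  shows "critical v q \<gamma> k {-1..k-1}"
proof -
  obtain c where "\<And>x. Y v q \<gamma> (k - 1) x = (\<Sum>j\<in>{-2..k-2}. c j *\<^sub>R Y v q \<gamma> j x) + 0"
    using assms evolves_by_Killing_field_iff[of "k - 1" v q] by fastforce
  then have "\<exists>c u. \<forall>x. Y v q \<gamma> (k - 1) x = (\<Sum>j\<in>{-2..k-2}. c j *\<^sub>R Y v q \<gamma> j x) + u"
    by blast
  then show ?thesis
    using critical_iff_dependent_mod_constant[of k "-1" v q "k - 1"] assms by simp
qed

text \<open>
  Integrating once lowers the order: a translation \<open>w\<close> becomes a screw motion with angular velocity
  \<open>w\<close>, since \<open>T \<times> w = - (w \<times> \<gamma>)'\<close>. The proof places \<open>w\<close> itself in the role of the axis vector.
\<close>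

lemma evolves_by_translation_imp_screw:
  assumes "k \<ge> 1" and "evolves_by v q \<gamma> k (\<lambda>p. w)"
  obtains u where "evolves_by v q \<gamma> (k - 1) (\<lambda>p. cross3 w p + u)"
proof -
  let ?Y = "Y w 0 \<gamma>" and ?G = "G w 0 \<gamma>"
  obtain c where "\<And>x. ?Y k x = (\<Sum>j\<in>{0..k-1}. c j *\<^sub>R ?Y j x) + w"
    using assms evolves_by_axis_independent[of k v q "\<lambda>p. w" w 0] unfolding evolves_by_def by auto
  then have "?Y k x = (\<Sum>j\<in>{-1..k-1}. (c(-1 := 1)) j *\<^sub>R ?Y j x)" for x
    using assms by (simp add: sum_with_translation)
  then have "?G k x = (\<Sum>j\<in>{-1..k-1}. (c(-1 := 1)) j *\<^sub>R ?G j x)" for x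
    by (simp only: G_def[of w 0 \<gamma> k] cross_tangent_Y_combination)
  also have "(\<Sum>j\<in>{-1..k-1}. (c(-1 := 1)) j *\<^sub>R ?G j x) =
      (\<Sum>j\<in>{-2..k-2}. (c(-1 := 1)) (j + 1) *\<^sub>R ?G (j + 1) x)" for x
    by (rule sum.reindex_bij_witness[where i = "\<lambda>j. j + 1" and j = "\<lambda>j. j - 1"]) auto
  finally have *: "?G (k - 1 + 1) x = (\<Sum>j\<in>{-2..k-2}. (c(-1 := 1)) (j + 1) *\<^sub>R ?G (j + 1) x)" for x
    by simp
  then obtain u where
    "\<And>x. ?Y (k - 1) x = (\<Sum>j\<in>{-2..k-2}. (c(-1 := 1)) (j + 1) *\<^sub>R ?Y j x) + u"
    using G_dependence_iff[of "k - 1" "{-2..k-2}" w 0 "\<lambda>j. (c(-1 := 1)) (j + 1)"] assms by auto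
  then have "?Y (k - 1) x = (\<Sum>j\<in>{0..k-2}. (c(-1 := 1)) (j + 1) *\<^sub>R ?Y j x)
      + (cross3 w (\<gamma> x) + (c 0 *\<^sub>R w + u))" for x
    using sum_with_Killing_fields[of "k - 1" "\<lambda>j. (c(-1 := 1)) (j + 1)" w 0 x] assms
    by (simp add: add.assoc)
  then have "evolves_by w 0 \<gamma> (k - 1) (\<lambda>p. cross3 w p + (c 0 *\<^sub>R w + u))"
    unfolding evolves_by_def by (intro exI[of _ "\<lambda>j. (c(-1 := 1)) (j + 1)"]) simp
  then show thesis
    using that assms evolves_by_axis_independent[of "k - 1" v q "\<lambda>p. cross3 w p + (c 0 *\<^sub>R w + u)" w 0]
    by simp
qed

end


section \<open>Rigid motions and their axes\<close>

lemma rotation_matrix_inner: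
  assumes "rotation_matrix (A :: real^3^3)"
  shows "(A *v x) \<bullet> (A *v y) = x \<bullet> y"
  using assms orthogonal_transformation_matrix[of "(*v) A"]
  by (simp add: rotation_matrix_def orthogonal_transformation_def)

lemma rotation_matrix_norm: "rotation_matrix (A :: real^3^3) \<Longrightarrow> norm (A *v x) = norm x"
  by (simp add: norm_eq_sqrt_inner rotation_matrix_inner)

text \<open>
  If \<open>v\<close> and \<open>w\<close> were independent, then every displacement \<open>A p - p\<close> would be orthogonal to
  \<open>v\<close>, \<open>w\<close> and \<open>v \<times> w\<close>.
\<close>

lemma fixed_vectors_of_rotation_parallel:
  assumes rot: "rotation_matrix (A :: real^3^3)" and "A \<noteq> mat 1"
    and v: "A *v v = v" and w: "A *v w = w"
  shows "cross3 v w = 0"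
proof (rule ccontr)
  assume nonzero: "cross3 v w \<noteq> 0"
  have "A *v p = p" for p
  proof -
    let ?d = "A *v p - p"
    have orth: "?d \<bullet> f = 0" if "A *v f = f" for f
      using rotation_matrix_inner[OF rot, of p f] that by (simp add: inner_diff_left)
    have "A *v cross3 v w = cross3 v w"
      using cross_rotation_matrix[OF rot, of v w] v w by simp
    then have "?d \<bullet> cross3 v w = 0" and "cross3 ?d (cross3 v w) = 0"
      using orth v w by (simp_all add: Lagrange)
    then have "?d = 0"
      using norm_and_cross_eq_0 nonzero by blast
    then show ?thesis by simp
  qed
  then have "A = mat 1"
    by (simp add: matrix_eq)
  with \<open>A \<noteq> mat 1\<close> show False by simp
qed

lemma parallel_to_unit_vector:
  assumes "norm v = 1" and "cross3 v w = 0"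
  shows "w = (v \<bullet> w) *\<^sub>R v"
  using Lagrange[of v v w] assms by (simp add: dot_square_norm)

text \<open>
  For \<open>A\<close> different from the identity, a Killing field \<open>p \<mapsto> w \<times> p + u\<close> that is related to
  itself by \<open>p \<mapsto> A p + a\<close> is a screw motion about the axis: the angular velocity \<open>w\<close> and
  the value of the field at \<open>q\<close> are both fixed by \<open>A\<close>, hence both parallel to \<open>v\<close>.
\<close>

lemma invariant_Killing_field_about_axis:
  assumes rot: "rotation_matrix A" and "A \<noteq> mat 1" and axis: "monodromy_axis A a v q"
    and w: "A *v w = w" and u: "cross3 w a + u = A *v u"
  obtains \<alpha> \<beta> where "\<And>p. cross3 w p + u = \<alpha> *\<^sub>R cross3 v (p - q) + \<beta> *\<^sub>R v"
proof -
  have v: "norm v = 1" "A *v v = v" and q: "cross3 v (A *v q + a - q) = 0"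
    using axis by (auto simp: monodromy_axis_def)
  have w_eq: "w = (v \<bullet> w) *\<^sub>R v"
    by (rule parallel_to_unit_vector[OF v(1) fixed_vectors_of_rotation_parallel[OF rot assms(2) v(2) w]])
  have "cross3 w (A *v q + a - q) = 0"
    by (subst w_eq) (simp add: cross_mult_left q)
  moreover have "A *v cross3 w q = cross3 w (A *v q)"
    using cross_rotation_matrix[OF rot, of w q] w by simp
  moreover have "A *v (cross3 w q + u) = A *v cross3 w q + (cross3 w a + u)"
    by (simp add: matrix_vector_right_distrib u)
  ultimately have "A *v (cross3 w q + u) = cross3 w q + u"
    by (simp add: Cross3.right_diff_distrib cross_add_right add.assoc[symmetric])
  then have "cross3 w q + u = (v \<bullet> (cross3 w q + u)) *\<^sub>R v"
    by (rule parallel_to_unit_vector[OF v(1) fixed_vectors_of_rotation_parallel[OF rot assms(2) v(2)]])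
  moreover have "cross3 w p + u = cross3 w (p - q) + (cross3 w q + u)" for p
    by (simp add: Cross3.right_diff_distrib)
  moreover have "cross3 w (p - q) = (v \<bullet> w) *\<^sub>R cross3 v (p - q)" for p
    by (subst w_eq) (simp add: cross_mult_left)
  ultimately show thesis
    using that by metis
qed

text \<open>
  The axis consists of the points where the Killing field is parallel to \<open>w\<close>; the one closest
  to the origin is \<open>(w \<times> u) / |w|\<^sup>2\<close>.
\<close>

lemma screw_axis_exists:
  assumes "w \<noteq> 0"
  obtains q \<beta> where
    "\<And>p. cross3 w p + u = norm w *\<^sub>R cross3 (sgn w) (p - q) + \<beta> *\<^sub>R sgn w"
proof -
  let ?q = "(1 / (w \<bullet> w)) *\<^sub>R cross3 w u"
  have nw: "norm w *\<^sub>R cross3 (sgn w) p = cross3 w p" for p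
    using assms by (simp add: sgn_div_norm cross_mult_left)
  have "cross3 w ?q = ((w \<bullet> u) / (w \<bullet> w)) *\<^sub>R w - u"
    using assms by (simp add: cross_mult_right Lagrange scaleR_diff_right)
  also have "((w \<bullet> u) / (w \<bullet> w)) *\<^sub>R w = ((w \<bullet> u) / norm w) *\<^sub>R sgn w"
    by (simp add: sgn_div_norm dot_square_norm power2_eq_square divide_inverse)
  finally have *: "cross3 w ?q = ((w \<bullet> u) / norm w) *\<^sub>R sgn w - u" .
  have "cross3 w p + u = norm w *\<^sub>R cross3 (sgn w) (p - ?q) + ((w \<bullet> u) / norm w) *\<^sub>R sgn w" for p
    unfolding nw[of "p - ?q"] by (simp only: Cross3.right_diff_distrib *) simp
  then show thesis
    by (rule that)
qed

lemma monodromy_axis_of_translation: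
  assumes "x \<noteq> 0" and "cross3 x a = 0"
  shows "monodromy_axis (mat 1) a (sgn x) q"
  using assms by (simp add: monodromy_axis_def norm_sgn sgn_div_norm cross_mult_left)


section \<open>Equivariance under the monodromy\<close>

text \<open>
  A fixed-point free continuous map of the line moves all points to the same side, hence some
  \<open>z\<close> far out is moved beyond any given value; this decides between the two possible directions
  of monotonicity.
\<close>

lemma line_translation_strict_mono:
  assumes "line_translation \<tau>"
  shows "strict_mono \<tau>"
proof (rule strict_monoI)
  have cont: "continuous_on S \<tau>" for S
    using assms smooth_imp_has_vector_derivative has_vector_derivative_continuous
    unfolding line_translation_def
    by (metis continuous_at_imp_continuous_on)
  have inj: "inj_on \<tau> S" for S
    using assms unfolding line_translation_def by (meson bij_is_inj inj_on_subset subset_UNIV)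
  have no_fix: "\<tau> x \<noteq> x" for x
    using assms unfolding line_translation_def by blast
  have side: "(\<tau> y > y) = (\<tau> x > x)" if "x \<le> y" for x y
  proof (rule ccontr)
    assume "(\<tau> y > y) \<noteq> (\<tau> x > x)"
    then have "(\<tau> x - x \<le> 0 \<and> 0 \<le> \<tau> y - y) \<or> (\<tau> y - y \<le> 0 \<and> 0 \<le> \<tau> x - x)"
      by auto
    moreover have "continuous_on {x..y} (\<lambda>t. \<tau> t - t)"
      by (intro continuous_intros cont)
    ultimately obtain t where "\<tau> t - t = 0"
      using IVT'[of "\<lambda>t. \<tau> t - t" x 0 y] IVT2'[of "\<lambda>t. \<tau> t - t" y 0 x] \<open>x \<le> y\<close> by blast
    with no_fix show False by simp
  qed
  fix x y :: real
  assume "x < y"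
  show "\<tau> x < \<tau> y"
  proof (cases "\<tau> x > x")
    case True
    define z where "z = max y (\<tau> x) + 1"
    have z: "y < z" "\<tau> x < z"
      by (auto simp: z_def)
    then have "z < \<tau> z"
      using side[of x z] True \<open>x < y\<close> by simp
    then show ?thesis
      using continuous_inj_imp_mono[OF \<open>x < y\<close> \<open>y < z\<close> cont inj] z by linarith
  next
    case False
    define z where "z = min x (\<tau> y) - 1"
    have z: "z < x" "z < \<tau> y"
      by (auto simp: z_def)
    then have "\<tau> z \<le> z"
      using side[of z x] False by simp
    then show ?thesis
      using continuous_inj_imp_mono[OF \<open>z < x\<close> \<open>x < y\<close> cont inj] z by linarith
  qed
qed

locale monodromy_curve =
  fixes \<tau> :: "real \<Rightarrow> real" and A :: "real^3^3" and a :: "real^3" and \<gamma> :: "real \<Rightarrow> real^3"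
  assumes translation: "line_translation \<tau>"
    and rotation: "rotation_matrix A"
    and curve: "\<gamma> \<in> curves \<tau> A a"

sublocale monodromy_curve \<subseteq> immersed_curve \<gamma>
  using curve by unfold_locales (auto simp: curves_def)

context monodromy_curve
begin

lemma monodromy: "\<gamma> (\<tau> x) = A *v \<gamma> x + a"
  using curve by (simp add: curves_def)

lemma \<tau>_has_vector_derivative: "(\<tau> has_vector_derivative vector_derivative \<tau> (at x)) (at x)"
  using translation smooth_imp_has_vector_derivative unfolding line_translation_def by blast

lemma \<tau>_deriv_nonneg: "vector_derivative \<tau> (at x) \<ge> 0"
  using mono_on_imp_deriv_nonneg[of UNIV \<tau> "vector_derivative \<tau> (at x)" x]
    \<tau>_has_vector_derivative[of x] line_translation_strict_mono[OF translation]
  by (simp add: strict_mono_mono has_real_derivative_iff_has_vector_derivative)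

lemma vector_derivative_equivariant:
  assumes "smooth F" and F: "\<And>x. F (\<tau> x) = A *v F x + b"
  shows "vector_derivative \<tau> (at x) *\<^sub>R vector_derivative F (at (\<tau> x)) = A *v vector_derivative F (at x)"
proof -
  have "((F \<circ> \<tau>) has_vector_derivative
      vector_derivative \<tau> (at x) *\<^sub>R vector_derivative F (at (\<tau> x))) (at x)"
    by (intro vector_diff_chain_at \<tau>_has_vector_derivative smooth_imp_has_vector_derivative assms)
  moreover have "((\<lambda>x. A *v F x + b) has_vector_derivative A *v vector_derivative F (at x) + 0) (at x)"
    by (intro has_vector_derivative_add has_vector_derivative_const
        bounded_linear.has_vector_derivative[OF matrix_vector_mul_bounded_linear]
        smooth_imp_has_vector_derivative assms)
  moreover have "F \<circ> \<tau> = (\<lambda>x. A *v F x + b)"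
    using F by auto
  ultimately show ?thesis
    using vector_derivative_unique_at by fastforce
qed

lemma speed_equivariant: "vector_derivative \<tau> (at x) * speed (\<tau> x) = speed x"
proof -
  have "norm (vector_derivative \<tau> (at x) *\<^sub>R vector_derivative \<gamma> (at (\<tau> x))) = speed x"
    using vector_derivative_equivariant[OF smooth_curve monodromy] rotation_matrix_norm[OF rotation]
    by simp
  then show ?thesis
    using \<tau>_deriv_nonneg by simp
qed

lemma arclength_deriv_equivariant:
  assumes "smooth F" and "\<And>x. F (\<tau> x) = A *v F x + b"
  shows "D F (\<tau> x) = A *v D F x"
proof -
  let ?t = "vector_derivative \<tau> (at x)"
  have "?t \<noteq> 0"
    using speed_equivariant[of x] regular[of x] by auto
  then have "vector_derivative F (at (\<tau> x)) = (A *v vector_derivative F (at x)) /\<^sub>R ?t"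
    by (simp add: vector_derivative_equivariant[OF assms, of x, symmetric])
  then show ?thesis
    using \<open>?t \<noteq> 0\<close>
    by (simp add: arclength_deriv_def speed_equivariant[of x, symmetric] matrix_vector_mult_scaleR mult.commute)
qed

lemma tangent_equivariant: "T (\<tau> x) = A *v T x"
  unfolding tangent_def by (rule arclength_deriv_equivariant[OF smooth_curve monodromy])

lemma Y_nat_equivariant: "Y_nat \<gamma> n (\<tau> x) = A *v Y_nat \<gamma> n x"
proof (induction n arbitrary: x rule: less_induct)
  case (less n)
  show ?case
  proof (cases n)
    case 0
    then show ?thesis by (simp add: tangent_equivariant)
  next
    case (Suc k)
    have "D (Y_nat \<gamma> k) (\<tau> x) = A *v D (Y_nat \<gamma> k) x"
      by (rule arclength_deriv_equivariant[where b = 0]) (use less.IH Suc smooth_Y_nat in auto)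
    moreover have "(\<Sum>i\<in>{1..k}. Y_nat \<gamma> i (\<tau> x) \<bullet> Y_nat \<gamma> (k - i + 1) (\<tau> x)) =
        (\<Sum>i\<in>{1..k}. Y_nat \<gamma> i x \<bullet> Y_nat \<gamma> (k - i + 1) x)"
    proof (rule sum.cong)
      fix i
      assume "i \<in> {1..k}"
      then have "i < n" and "k - i + 1 < n"
        using Suc by auto
      then show "Y_nat \<gamma> i (\<tau> x) \<bullet> Y_nat \<gamma> (k - i + 1) (\<tau> x) = Y_nat \<gamma> i x \<bullet> Y_nat \<gamma> (k - i + 1) x"
        by (simp only: less.IH rotation_matrix_inner[OF rotation])
    qed simp
    ultimately show ?thesis
      unfolding Suc Y_nat.simps(2)
      by (simp only: tangent_equivariant cross_rotation_matrix[OF rotation]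
          matrix_vector_mult_diff_distrib matrix_vector_mult_scaleR)
  qed
qed

text \<open>
  The flows of index at least \<open>0\<close> are equivariant under the monodromy, so a vector field on
  space that agrees along \<open>\<gamma>\<close> with a combination of them is equivariant along \<open>\<gamma>\<close>.
\<close>

lemma evolves_by_equivariant:
  assumes "m \<ge> 0" and "evolves_by v q \<gamma> m X"
  shows "X (A *v \<gamma> x + a) = A *v X (\<gamma> x)"
proof -
  obtain c where c: "\<And>x. Y v q \<gamma> m x = (\<Sum>i\<in>{0..m-1}. c i *\<^sub>R Y v q \<gamma> i x) + X (\<gamma> x)"
    using assms unfolding evolves_by_def by blast
  have equi: "Y v q \<gamma> j (\<tau> x) = A *v Y v q \<gamma> j x" if "j \<ge> 0" for j
    using that by (simp add: Y_nonneg Y_nat_equivariant)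
  have "(\<Sum>i\<in>{0..m-1}. c i *\<^sub>R Y v q \<gamma> i (\<tau> x)) = A *v (\<Sum>i\<in>{0..m-1}. c i *\<^sub>R Y v q \<gamma> i x)"
    by (simp add: equi linear_sum[OF matrix_vector_mul_linear] matrix_vector_mult_scaleR)
  then show ?thesis
    using c[of "\<tau> x"] c[of x] equi[OF assms(1)] by (simp add: matrix_vector_right_distrib monodromy)
qed

lemma translation_flow_monodromy:
  assumes "k \<ge> 1" and "evolves_by v q \<gamma> k (\<lambda>p. w)"
  obtains u where "A *v w = w" and "cross3 w a + u = A *v u"
    and "evolves_by v q \<gamma> (k - 1) (\<lambda>p. cross3 w p + u)"
proof -
  have w: "A *v w = w"
    using evolves_by_equivariant[OF _ assms(2)] assms(1) by simp
  obtain u where u: "evolves_by v q \<gamma> (k - 1) (\<lambda>p. cross3 w p + u)"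
    using evolves_by_translation_imp_screw[OF assms] by blast
  have "cross3 w (A *v \<gamma> 0 + a) + u = A *v (cross3 w (\<gamma> 0) + u)"
    using evolves_by_equivariant[OF _ u] assms(1) by simp
  moreover have "A *v cross3 w (\<gamma> 0) = cross3 w (A *v \<gamma> 0)"
    using cross_rotation_matrix[OF rotation, of w "\<gamma> 0"] w by simp
  ultimately have "cross3 w a + u = A *v u"
    by (simp add: matrix_vector_right_distrib cross_add_right)
  then show thesis
    by (rule that[OF w _ u])
qed

text \<open>
  For \<open>k \<ge> 1\<close> this is the invariance of the associated Killing field. For \<open>k = 0\<close> the
  curve is a straight line with direction \<open>w\<close>, and \<open>a\<close> translates it along itself.
\<close>

lemma translation_flow_parallel_to_monodromy:
  assumes "A = mat 1" and "k \<ge> 0" and ev: "evolves_by v q \<gamma> k (\<lambda>p. w)"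
  shows "cross3 w a = 0"
proof (cases "k = 0")
  case True
  then have "T x = w" for x
    using ev by (simp add: evolves_by_def Y_zero)
  moreover have "((\<lambda>x. cross3 w (\<gamma> x)) has_vector_derivative
      cross3 w (speed x *\<^sub>R T x) + cross3 0 (\<gamma> x)) (at x)" for x
    by (intro bounded_bilinear.has_vector_derivative[OF bounded_bilinear_cross3]
        has_vector_derivative_const has_tangent)
  ultimately have "((\<lambda>x. cross3 w (\<gamma> x)) has_vector_derivative 0) (at x)" for x
    by (simp add: cross_mult_right)
  from constant_if_vector_derivative_zero[OF this] obtain b where "\<And>x. cross3 w (\<gamma> x) = b"
    by blast
  then have "cross3 w (\<gamma> (\<tau> 0)) = cross3 w (\<gamma> 0)"
    by simp
  then show ?thesis
    using assms(1) by (simp add: monodromy cross_add_right)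
next
  case False
  then obtain u where "cross3 w a + u = A *v u"
    using translation_flow_monodromy[of k v q w] ev assms(2) by auto
  then show ?thesis
    using assms(1) by simp
qed

text \<open>
  When the monodromy is a pure translation, its axis is not determined by it, and the curve
  itself has to single one out: the axis of the screw motion if that rotates, and else the
  direction of its translational part. If the screw motion is trivial, any axis serves.
\<close>

lemma translation_flow_imp_screw_about_some_axis:
  assumes "A = mat 1" and axis: "monodromy_axis A a v q" and k: "k \<ge> 1"
    and ev: "evolves_by v q \<gamma> k (\<lambda>p. w)"
  obtains v' q' \<alpha> \<beta> where "monodromy_axis A a v' q'" and "w \<in> span {v'}"
    and "evolves_by v' q' \<gamma> (k - 1) (\<lambda>p. \<alpha> *\<^sub>R cross3 v' (p - q') + \<beta> *\<^sub>R v')"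
proof -
  obtain u where u: "evolves_by v q \<gamma> (k - 1) (\<lambda>p. cross3 w p + u)"
    using translation_flow_monodromy[OF k ev] by blast
  have ev': "evolves_by v' q' \<gamma> (k - 1) (\<lambda>p. cross3 w p + u)" for v' q'
    using evolves_by_axis_independent[of "k - 1" v q _ v' q'] u k by simp
  show thesis
  proof (cases "w = 0")
    case False
    obtain q' \<beta> where
      "\<And>p. cross3 w p + u = norm w *\<^sub>R cross3 (sgn w) (p - q') + \<beta> *\<^sub>R sgn w"
      using screw_axis_exists[OF False] by blast
    then have "evolves_by (sgn w) q' \<gamma> (k - 1)
        (\<lambda>p. norm w *\<^sub>R cross3 (sgn w) (p - q') + \<beta> *\<^sub>R sgn w)"
      using ev'[of "sgn w" q'] by simp
    moreover have "monodromy_axis A a (sgn w) q'"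
      using monodromy_axis_of_translation[OF False] assms(1) k ev
        translation_flow_parallel_to_monodromy[of k v q w] by simp
    moreover have "w \<in> span {sgn w}"
      using False span_scale[OF span_base[of "sgn w" "{sgn w}"], of "norm w"]
      by (simp add: sgn_div_norm)
    ultimately show thesis
      using that by blast
  next
    case True
    show thesis
    proof (cases "u = 0")
      case True
      then show thesis
        using that[OF axis, of 0 0] ev'[of v q] \<open>w = 0\<close> by (simp add: span_zero)
    next
      case False
      have "cross3 u a = 0"
        using translation_flow_parallel_to_monodromy[of "k - 1" v q u] ev'[of v q] k assms(1) \<open>w = 0\<close>
        by simp
      then have "monodromy_axis A a (sgn u) q"
        using monodromy_axis_of_translation[OF False] assms(1) by simp
      moreover have "evolves_by (sgn u) q \<gamma> (k - 1)
          (\<lambda>p. 0 *\<^sub>R cross3 (sgn u) (p - q) + norm u *\<^sub>R sgn u)"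
        using ev'[of "sgn u" q] False \<open>w = 0\<close> by (simp add: sgn_div_norm)
      ultimately show thesis
        using that \<open>w = 0\<close> by (metis span_zero)
    qed
  qed
qed

lemma translation_flow_imp_screw_about_axis:
  assumes "A \<noteq> mat 1" and axis: "monodromy_axis A a v q" and k: "k \<ge> 1"
    and ev: "evolves_by v q \<gamma> k (\<lambda>p. w)"
  shows "\<exists>\<alpha> \<beta>. evolves_by v q \<gamma> (k - 1) (\<lambda>p. \<alpha> *\<^sub>R cross3 v (p - q) + \<beta> *\<^sub>R v)"
proof -
  obtain u where "A *v w = w" "cross3 w a + u = A *v u"
    and u: "evolves_by v q \<gamma> (k - 1) (\<lambda>p. cross3 w p + u)"
    using translation_flow_monodromy[OF k ev] by blast
  then obtain \<alpha> \<beta> where "\<And>p. cross3 w p + u = \<alpha> *\<^sub>R cross3 v (p - q) + \<beta> *\<^sub>R v"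
    using invariant_Killing_field_about_axis[OF rotation assms(1) axis] by blast
  with u show ?thesis
    by auto
qed

lemma translation_flow_along_axis:
  assumes axis: "monodromy_axis A a v q" and k: "k \<ge> 1"
    and ev: "evolves_by v q \<gamma> k (\<lambda>p. w)"
  shows "A *v w = w" and "\<exists>v' q'. monodromy_axis A a v' q' \<and> w \<in> span {v'}"
proof -
  show w: "A *v w = w"
    using translation_flow_monodromy[OF k ev] by blast
  show "\<exists>v' q'. monodromy_axis A a v' q' \<and> w \<in> span {v'}"
  proof (cases "A = mat 1")
    case True
    then show ?thesis
      using translation_flow_imp_screw_about_some_axis[OF True axis k ev] by blast
  next
    case False
    have "norm v = 1" and "A *v v = v"
      using axis by (auto simp: monodromy_axis_def)
    then have "w = (v \<bullet> w) *\<^sub>R v"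
      using parallel_to_unit_vector fixed_vectors_of_rotation_parallel[OF rotation False _ w] by blast
    then have "w \<in> span {v}"
      by (metis span_base span_scale singletonI)
    with axis show ?thesis by blast
  qed
qed

end

theorem theorem8:
  fixes \<tau> :: "real \<Rightarrow> real" and A :: "real^3^3" and a v q :: "real^3"
    and \<gamma> :: "real \<Rightarrow> real^3" and k :: int
  assumes "line_translation \<tau>"
    and "rotation_matrix A"
    and "monodromy_axis A a v q"
    and "\<gamma> \<in> curves \<tau> A a"
    and "k \<ge> 1"
  shows
    "let
       i   = (\<lambda>v q. critical v q \<gamma> (k + 1) {1..k});
       ii  = (\<lambda>v q. critical v q \<gamma> k {-1..k - 1});
       iii = (\<lambda>v q. critical v q \<gamma> (k - 1) {-2..k - 2});
       iv  = (\<lambda>v q. \<exists>w. evolves_by v q \<gamma> k (\<lambda>p. w));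
       v5  = (\<lambda>v q. \<exists>\<alpha> \<beta>. evolves_by v q \<gamma> (k - 1) (\<lambda>p. \<alpha> *\<^sub>R cross3 v (p - q) + \<beta> *\<^sub>R v));
       equivalent = (\<lambda>v q. (i v q \<longleftrightarrow> ii v q) \<and> (k \<ge> 2 \<longrightarrow> (i v q \<longleftrightarrow> iii v q)) \<and>
                           (i v q \<longleftrightarrow> iv v q) \<and> (i v q \<longleftrightarrow> v5 v q))
     in
       (A \<noteq> mat 1 \<longrightarrow> equivalent v q) \<and>
       (A = mat 1 \<longrightarrow>
          (\<exists>v' q'. monodromy_axis A a v' q' \<and> equivalent v' q') \<and>
          (i v q \<longleftrightarrow> iv v q) \<and>
          (ii v q \<or> (k \<ge> 2 \<and> iii v q) \<or> v5 v q \<longrightarrow> i v q)) \<and>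
       (\<forall>w. evolves_by v q \<gamma> k (\<lambda>p. w) \<longrightarrow>
          A *v w = w \<and> (\<exists>v' q'. monodromy_axis A a v' q' \<and> w \<in> span {v'}))"
proof -
  interpret monodromy_curve \<tau> A a \<gamma>
    using assms by unfold_locales
  define i where "i = (\<lambda>v q. critical v q \<gamma> (k + 1) {1..k})"
  define ii where "ii = (\<lambda>v q. critical v q \<gamma> k {-1..k - 1})"
  define iii where "iii = (\<lambda>v q. critical v q \<gamma> (k - 1) {-2..k - 2})"
  define iv where "iv = (\<lambda>v q. \<exists>w. evolves_by v q \<gamma> k (\<lambda>p. w))"
  define v5 where
    "v5 = (\<lambda>v q. \<exists>\<alpha> \<beta>. evolves_by v q \<gamma> (k - 1) (\<lambda>p. \<alpha> *\<^sub>R cross3 v (p - q) + \<beta> *\<^sub>R v))"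
  define equivalent where
    "equivalent = (\<lambda>v q. (i v q \<longleftrightarrow> ii v q) \<and> (k \<ge> 2 \<longrightarrow> (i v q \<longleftrightarrow> iii v q)) \<and>
      (i v q \<longleftrightarrow> iv v q) \<and> (i v q \<longleftrightarrow> v5 v q))"
  have i_iv: "i v q \<longleftrightarrow> iv v q" for v q
    unfolding i_def iv_def by (rule critical_iff_evolves_by_translation[OF \<open>k \<ge> 1\<close>])
  have ii_iv: "ii v q \<Longrightarrow> iv v q" for v q
    unfolding ii_def iv_def by (rule critical_imp_evolves_by_translation[OF \<open>k \<ge> 1\<close>])
  have v5_ii: "v5 v q \<Longrightarrow> ii v q" for v q
    unfolding v5_def ii_def by (rule evolves_by_Killing_field_imp_critical[OF \<open>k \<ge> 1\<close>])
  have iii_v5: "iii v q \<longleftrightarrow> v5 v q" if "k \<ge> 2" for v q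
    unfolding iii_def v5_def by (rule critical_iff_evolves_by_Killing_field[OF that])
  have equivalentI: "equivalent v q" if "iv v q \<Longrightarrow> v5 v q" for v q
    unfolding equivalent_def using that i_iv ii_iv v5_ii iii_v5 by blast
  (* Only the step from (iv) to (v) needs a particular axis; where (iv) fails, any axis will do. *)
  have "equivalent v q" if "A \<noteq> mat 1"
    using equivalentI translation_flow_imp_screw_about_axis[OF that assms(3,5)]
    unfolding iv_def v5_def by blast
  moreover have "\<exists>v' q'. monodromy_axis A a v' q' \<and> equivalent v' q'" if id: "A = mat 1"
  proof (cases "iv v q")
    case True
    then obtain v' q' where "monodromy_axis A a v' q'" and "v5 v' q'"
      using translation_flow_imp_screw_about_some_axis[OF id assms(3,5)]
      unfolding iv_def v5_def by metis
    then show ?thesis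
      using equivalentI by blast
  next
    case False
    then show ?thesis
      using equivalentI assms(3) by blast
  qed
  moreover have "ii v q \<or> (k \<ge> 2 \<and> iii v q) \<or> v5 v q \<longrightarrow> i v q"
    using i_iv ii_iv v5_ii iii_v5 by blast
  ultimately show ?thesis
    unfolding Let_def
    using i_iv translation_flow_along_axis[OF assms(3,5)]
    unfolding equivalent_def i_def ii_def iii_def iv_def v5_def by blast
qed

end
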